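(* Let $(M,<,\dots)$ be a linearly finite structure and $f:M\to M$ a definable function. Then the relation $f(x)=y$ is defined by a finite disjunction of the form $\bigvee_{i\in I}\big(\theta_i(x)\wedge S^{N_i}_{E_i}(x)=\{y\}\big)$ for some formulae $\theta_i(x)$, definable convex equivalence relations $E_i$ and integers $N_i$ ($i\in I$). In particular, $f$ is the union of finitely many definable increasing functions.
   Context: A linearly ordered structure is a first-order structure $(M,<,\dots)$ with $<$ a linear order; "definable" means definable without parameters. It is linearly finite if for every partitioned formula $\phi(\bar x;\bar y)$ there is an integer $n_\phi$ such that for every initial (downward closed) part $C\subset M$, at most $n_\phi$ complete $\phi$-types with parameters from $C$ are realized in $M\setminus C$. For a definable convex equivalence relation $E$ (all classes convex) and $N\in\mathbb Z$: for $N>0$, $S^N_E(x,y)$ expresses that the $N$-th consecutive $E$-class succeeding $[x]_E$ exists and contains $y$; $S^0_E(x,y)$ is $E(x,y)$; for $N<0$, $S^N_E(x,y):=S^{-N}_E(y,x)$; $S^N_E(a)=\{b: S^N_E(a,b)\}$, and $S^N_E(x)=\{y\}$ expresses that this set is the singleton $\{y\}$. *)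

theory Defs
  imports Main
begin

datatype 'f trm = Var nat | Fun 'f "'f trm list"

text \<open>The order is a logical symbol of every language: \<open>Less\<close> is always interpreted by the
  order of the universe. The type parameters only account for the remaining symbols.\<close>

datatype ('f, 'r) fm =
    Eq "'f trm" "'f trm"
  | Less "'f trm" "'f trm"
  | Rel 'r "'f trm list"
  | Neg "('f, 'r) fm"
  | Conj "('f, 'r) fm" "('f, 'r) fm"
  | Exists nat "('f, 'r) fm"

text \<open>A language is given by its symbols together with their arities. Either set may be empty,
  although the types \<open>'f\<close> and \<open>'r\<close> cannot be.\<close>

record ('f, 'r) lang =
  fun_syms :: "('f \<times> nat) set"
  rel_syms :: "('r \<times> nat) set"

text \<open>The universe is the linearly ordered type \<open>'a\<close>. The values of an interpretation at
  argument lists whose length is not an arity of the symbol are irrelevant, since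
  no formula of the language refers to them.\<close>

record ('a, 'f, 'r) struct =
  fun_int :: "'f \<Rightarrow> 'a list \<Rightarrow> 'a"
  rel_int :: "'r \<Rightarrow> 'a list \<Rightarrow> bool"

primrec trm_vars :: "'f trm \<Rightarrow> nat set" where
  "trm_vars (Var i) = {i}"
| "trm_vars (Fun f ts) = \<Union>(set (map trm_vars ts))"

primrec trm_of_lang :: "('f, 'r) lang \<Rightarrow> 'f trm \<Rightarrow> bool" where
  "trm_of_lang L (Var i) \<longleftrightarrow> True"
| "trm_of_lang L (Fun f ts) \<longleftrightarrow>
     (f, length ts) \<in> fun_syms L \<and> list_all id (map (trm_of_lang L) ts)"

primrec trm_val :: "('a, 'f, 'r) struct \<Rightarrow> (nat \<Rightarrow> 'a) \<Rightarrow> 'f trm \<Rightarrow> 'a" where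
  "trm_val M v (Var i) = v i"
| "trm_val M v (Fun f ts) = fun_int M f (map (trm_val M v) ts)"

primrec free_vars :: "('f, 'r) fm \<Rightarrow> nat set" where
  "free_vars (Eq s t) = trm_vars s \<union> trm_vars t"
| "free_vars (Less s t) = trm_vars s \<union> trm_vars t"
| "free_vars (Rel r ts) = \<Union>(set (map trm_vars ts))"
| "free_vars (Neg \<phi>) = free_vars \<phi>"
| "free_vars (Conj \<phi> \<psi>) = free_vars \<phi> \<union> free_vars \<psi>"
| "free_vars (Exists i \<phi>) = free_vars \<phi> - {i}"

primrec fm_of_lang :: "('f, 'r) lang \<Rightarrow> ('f, 'r) fm \<Rightarrow> bool" where
  "fm_of_lang L (Eq s t) \<longleftrightarrow> trm_of_lang L s \<and> trm_of_lang L t"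
| "fm_of_lang L (Less s t) \<longleftrightarrow> trm_of_lang L s \<and> trm_of_lang L t"
| "fm_of_lang L (Rel r ts) \<longleftrightarrow>
     (r, length ts) \<in> rel_syms L \<and> list_all (trm_of_lang L) ts"
| "fm_of_lang L (Neg \<phi>) \<longleftrightarrow> fm_of_lang L \<phi>"
| "fm_of_lang L (Conj \<phi> \<psi>) \<longleftrightarrow> fm_of_lang L \<phi> \<and> fm_of_lang L \<psi>"
| "fm_of_lang L (Exists i \<phi>) \<longleftrightarrow> fm_of_lang L \<phi>"

primrec sat :: "('a::linorder, 'f, 'r) struct \<Rightarrow> (nat \<Rightarrow> 'a) \<Rightarrow> ('f, 'r) fm \<Rightarrow> bool" where
  "sat M v (Eq s t) \<longleftrightarrow> trm_val M v s = trm_val M v t"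
| "sat M v (Less s t) \<longleftrightarrow> trm_val M v s < trm_val M v t"
| "sat M v (Rel r ts) \<longleftrightarrow> rel_int M r (map (trm_val M v) ts)"
| "sat M v (Neg \<phi>) \<longleftrightarrow> \<not> sat M v \<phi>"
| "sat M v (Conj \<phi> \<psi>) \<longleftrightarrow> sat M v \<phi> \<and> sat M v \<psi>"
| "sat M v (Exists i \<phi>) \<longleftrightarrow> (\<exists>a. sat M (v(i := a)) \<phi>)"

text \<open>The formulas of the language in the free variables \<open>v\<^sub>0, \<dots>, v\<^sub>n\<^sub>-\<^sub>1\<close>, and satisfaction of
  such a formula by an \<open>n\<close>-tuple, represented as a list of length \<open>n\<close>.\<close>

definition formulas :: "('f, 'r) lang \<Rightarrow> nat \<Rightarrow> ('f, 'r) fm set" where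
  "formulas L n = {\<phi>. fm_of_lang L \<phi> \<and> free_vars \<phi> \<subseteq> {..<n}}"

definition holds :: "('a::linorder, 'f, 'r) struct \<Rightarrow> ('f, 'r) fm \<Rightarrow> 'a list \<Rightarrow> bool" where
  "holds M \<phi> as \<longleftrightarrow> sat M (\<lambda>i. as ! i) \<phi>"

text \<open>Definability of a binary relation, without parameters.\<close>

definition definable_rel ::
    "('f, 'r) lang \<Rightarrow> ('a::linorder, 'f, 'r) struct \<Rightarrow> ('a \<times> 'a) set \<Rightarrow> bool" where
  "definable_rel L M R \<longleftrightarrow> (\<exists>\<phi>\<in>formulas L 2. R = {(x, y). holds M \<phi> [x, y]})"

definition graph_of :: "('a \<Rightarrow> 'a) \<Rightarrow> ('a \<times> 'a) set" where
  "graph_of f = {(x, y). f x = y}"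

definition definable_fun ::
    "('f, 'r) lang \<Rightarrow> ('a::linorder, 'f, 'r) struct \<Rightarrow> ('a \<Rightarrow> 'a) \<Rightarrow> bool" where
  "definable_fun L M f \<longleftrightarrow> definable_rel L M (graph_of f)"

definition tuples :: "nat \<Rightarrow> 'a set \<Rightarrow> 'a list set" where
  "tuples n A = {as. length as = n \<and> set as \<subseteq> A}"

text \<open>The complete \<open>\<phi>\<close>-type over \<open>C\<close> of the tuple \<open>as\<close>, where \<open>n\<close> is the length of the parameter
  tuples: the pair \<open>(True, cs)\<close> stands for the instance \<open>\<phi>(x; cs)\<close>, and \<open>(False, cs)\<close> for its
  negation.\<close>

definition phi_type ::
    "('a::linorder, 'f, 'r) struct \<Rightarrow> ('f, 'r) fm \<Rightarrow> nat \<Rightarrow> 'a set \<Rightarrow> 'a list \<Rightarrow> (bool \<times> 'a list) set"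
  where
  "phi_type M \<phi> n C as = {(s, cs). cs \<in> tuples n C \<and> (s \<longleftrightarrow> holds M \<phi> (as @ cs))}"

definition initial_part :: "'a::linorder set \<Rightarrow> bool" where
  "initial_part C \<longleftrightarrow> (\<forall>c\<in>C. \<forall>x. x \<le> c \<longrightarrow> x \<in> C)"

text \<open>In a partitioned formula \<open>\<phi>(x; y)\<close> the tuple \<open>x\<close> consists of the first \<open>m\<close> variables and \<open>y\<close>
  of the next \<open>n\<close>. Finiteness is explicit because \<open>card\<close> is \<open>0\<close> on infinite sets.\<close>

definition linearly_finite ::
    "('f, 'r) lang \<Rightarrow> ('a::linorder, 'f, 'r) struct \<Rightarrow> bool" where
  "linearly_finite L M \<longleftrightarrow>
     (\<forall>m n. \<forall>\<phi>\<in>formulas L (m + n). \<exists>k::nat. \<forall>C. initial_part C \<longrightarrow>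
        finite (phi_type M \<phi> n C ` tuples m (UNIV - C)) \<and>
        card (phi_type M \<phi> n C ` tuples m (UNIV - C)) \<le> k)"

definition convex_equiv :: "('a::linorder \<times> 'a) set \<Rightarrow> bool" where
  "convex_equiv E \<longleftrightarrow> equiv UNIV E \<and>
     (\<forall>A\<in>UNIV // E. \<forall>x\<in>A. \<forall>z\<in>A. \<forall>y. x \<le> y \<and> y \<le> z \<longrightarrow> y \<in> A)"

definition class_less :: "'a::linorder set \<Rightarrow> 'a set \<Rightarrow> bool" where
  "class_less A B \<longleftrightarrow> (\<forall>a\<in>A. \<forall>b\<in>B. a < b)"

definition next_class :: "('a::linorder \<times> 'a) set \<Rightarrow> 'a set \<Rightarrow> 'a set \<Rightarrow> bool" where
  "next_class E A B \<longleftrightarrow> A \<in> UNIV // E \<and> B \<in> UNIV // E \<and> class_less A B \<and>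
     \<not> (\<exists>D\<in>UNIV // E. class_less A D \<and> class_less D B)"

text \<open>\<open>S_rel E N x y\<close> is the relation \<open>S\<^sup>N\<^sub>E(x, y)\<close>, and \<open>S_set E N x\<close> is the set \<open>S\<^sup>N\<^sub>E(x)\<close>.\<close>

definition S_rel :: "('a::linorder \<times> 'a) set \<Rightarrow> int \<Rightarrow> 'a \<Rightarrow> 'a \<Rightarrow> bool" where
  "S_rel E N x y \<longleftrightarrow>
     (if N > 0 then (next_class E ^^ nat N) (E `` {x}) (E `` {y})
      else if N = 0 then (x, y) \<in> E
      else (next_class E ^^ nat (- N)) (E `` {y}) (E `` {x}))"

definition S_set :: "('a::linorder \<times> 'a) set \<Rightarrow> int \<Rightarrow> 'a \<Rightarrow> 'a set" where
  "S_set E N x = {y. S_rel E N x y}"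

text \<open>A partial function, given by its graph, which is increasing in the non-strict sense
  (constant functions are increasing).\<close>

definition increasing_partial_fun :: "('a::linorder \<times> 'a) set \<Rightarrow> bool" where
  "increasing_partial_fun g \<longleftrightarrow> single_valued g \<and>
     (\<forall>(x, y)\<in>g. \<forall>(x', y')\<in>g. x \<le> x' \<longrightarrow> y \<le> y')"

end

theory Submission imports Defs begin

text \<open>If \<open>C\<close> is an initial part, then the instances of \<open>f(x) = y\<close> over \<open>C\<close> separate
  the elements of \<open>f(C) \ C\<close> and those of \<open>f(M \ C) \<inter> C\<close>, so linear finiteness bounds both sets by
  some \<open>k\<close>. On \<open>{x. x < f x}\<close> a chain \<open>x > x\<^sub>1 > \<dots> > x\<^sub>n\<close> with
  \<open>f x < f x\<^sub>1 < \<dots> < f x\<^sub>n\<close> has length at most \<open>k\<close>, because these values cross the cut at \<open>x\<close>.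
  Hence the maximal length of such a chain splits \<open>{x. x < f x}\<close> into finitely many definable layers,
  and \<open>f\<close> is increasing on each of them. Let \<open>Y\<close> be the image of a layer and \<open>E\<close> the convex
  equivalence relation of realizing the same cut in \<open>Y\<close>. By monotonicity the points of \<open>Y\<close> between
  \<open>x\<close> and \<open>f x\<close> cross the cut at \<open>x\<close>, so there are at most \<open>k\<close> of them; therefore the class
  \<open>{f x}\<close> is the \<open>n\<close>-th successor of the class of \<open>x\<close> for some \<open>n \<le> 2 k + 2\<close>. The set
  \<open>{x. f x < x}\<close> is treated dually.\<close>

subsection \<open>Definability\<close>

lemma trm_val_cong: "(\<And>i. i \<in> trm_vars t \<Longrightarrow> v i = w i) \<Longrightarrow> trm_val M v t = trm_val M w t"
proof (induction t)
  case (Fun g ts)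
  have "map (trm_val M v) ts = map (trm_val M w) ts"
    using Fun by (intro map_cong[OF refl]) auto
  then show ?case by (simp del: map_eq_conv)
qed simp

lemma sat_cong: "(\<And>i. i \<in> free_vars \<phi> \<Longrightarrow> v i = w i) \<Longrightarrow> sat M v \<phi> = sat M w \<phi>"
proof (induction \<phi> arbitrary: v w)
  case (Eq s t)
  then have "trm_val M v s = trm_val M w s" "trm_val M v t = trm_val M w t"
    by (auto intro: trm_val_cong)
  then show ?case by simp
next
  case (Less s t)
  then have "trm_val M v s = trm_val M w s" "trm_val M v t = trm_val M w t"
    by (auto intro: trm_val_cong)
  then show ?case by simp
next
  case (Rel r ts)
  have "map (trm_val M v) ts = map (trm_val M w) ts"
    using Rel by (intro map_cong[OF refl] trm_val_cong) auto
  then show ?case by (simp del: map_eq_conv)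
next
  case (Neg \<phi>)
  have "sat M v \<phi> = sat M w \<phi>"
    using Neg.prems by (intro Neg.IH) auto
  then show ?case by simp
next
  case (Conj \<phi> \<psi>)
  have "sat M v \<phi> = sat M w \<phi>"
    using Conj.prems by (intro Conj.IH(1)) auto
  moreover have "sat M v \<psi> = sat M w \<psi>"
    using Conj.prems by (intro Conj.IH(2)) auto
  ultimately show ?case by simp
next
  case (Exists i \<phi>)
  have "sat M (v(i := a)) \<phi> = sat M (w(i := a)) \<phi>" for a
    using Exists.prems by (intro Exists.IH) auto
  then show ?case by simp
qed

lemma finite_trm_vars: "finite (trm_vars t)"
  by (induction t) auto

lemma finite_free_vars: "finite (free_vars \<phi>)"
  by (induction \<phi>) (auto simp: finite_trm_vars)

text \<open>Semantic counterpart of formulas: closure under connectives and quantifiers is proved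
  once for predicates on assignments, so later definability proofs need no syntax.\<close>

definition definable_pred ::
    "('f, 'r) lang \<Rightarrow> ('a::linorder, 'f, 'r) struct \<Rightarrow> ((nat \<Rightarrow> 'a) \<Rightarrow> bool) \<Rightarrow> bool" where
  "definable_pred L M P \<longleftrightarrow> (\<exists>\<phi>. fm_of_lang L \<phi> \<and> (\<forall>v. sat M v \<phi> = P v))"

definition definable1 ::
    "('f, 'r) lang \<Rightarrow> ('a::linorder, 'f, 'r) struct \<Rightarrow> ('a \<Rightarrow> bool) \<Rightarrow> bool" where
  "definable1 L M P \<longleftrightarrow> (\<forall>i. definable_pred L M (\<lambda>v. P (v i)))"

text \<open>Quantifying over all \<open>i\<close> and \<open>j\<close>, equal ones included, builds
  in renaming and identification of variables, so no substitution into formulas is required.\<close>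

definition definable2 ::
    "('f, 'r) lang \<Rightarrow> ('a::linorder, 'f, 'r) struct \<Rightarrow> ('a \<Rightarrow> 'a \<Rightarrow> bool) \<Rightarrow> bool" where
  "definable2 L M R \<longleftrightarrow> (\<forall>i j. definable_pred L M (\<lambda>v. R (v i) (v j)))"

definition definable3 ::
    "('f, 'r) lang \<Rightarrow> ('a::linorder, 'f, 'r) struct \<Rightarrow> ('a \<Rightarrow> 'a \<Rightarrow> 'a \<Rightarrow> bool) \<Rightarrow> bool" where
  "definable3 L M R \<longleftrightarrow> (\<forall>i j k. definable_pred L M (\<lambda>v. R (v i) (v j) (v k)))"

lemma definable_pred_eq: "definable_pred L M (\<lambda>v. v i = v j)"
  unfolding definable_pred_def by (intro exI[of _ "Eq (Var i) (Var j)"]) simp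

lemma definable_pred_less: "definable_pred L M (\<lambda>v. v i < v j)"
  unfolding definable_pred_def by (intro exI[of _ "Less (Var i) (Var j)"]) simp

lemma definable_pred_not: "definable_pred L M P \<Longrightarrow> definable_pred L M (\<lambda>v. \<not> P v)"
  unfolding definable_pred_def by (metis fm_of_lang.simps(4) sat.simps(4))

lemma definable_pred_conj:
  "definable_pred L M P \<Longrightarrow> definable_pred L M Q \<Longrightarrow> definable_pred L M (\<lambda>v. P v \<and> Q v)"
  unfolding definable_pred_def by (metis fm_of_lang.simps(5) sat.simps(5))

lemma definable_pred_imp:
  "definable_pred L M P \<Longrightarrow> definable_pred L M Q \<Longrightarrow> definable_pred L M (\<lambda>v. P v \<longrightarrow> Q v)"
  using definable_pred_not[OF definable_pred_conj[OF _ definable_pred_not], of L M P Q]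
  by simp

lemma definable_pred_iff:
  "definable_pred L M P \<Longrightarrow> definable_pred L M Q \<Longrightarrow> definable_pred L M (\<lambda>v. P v \<longleftrightarrow> Q v)"
  unfolding iff_conv_conj_imp by (intro definable_pred_conj definable_pred_imp)

lemma definable_pred_ex:
  "definable_pred L M P \<Longrightarrow> definable_pred L M (\<lambda>v. \<exists>a. P (v(i := a)))"
  unfolding definable_pred_def by (metis fm_of_lang.simps(6) sat.simps(6))

lemma definable1_pred: "definable1 L M P \<Longrightarrow> definable_pred L M (\<lambda>v. P (v i))"
  by (simp add: definable1_def)

lemma definable2_pred: "definable2 L M R \<Longrightarrow> definable_pred L M (\<lambda>v. R (v i) (v j))"
  by (simp add: definable2_def)

lemmas definable_intros = definable_pred_eq definable_pred_less definable_pred_not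
  definable_pred_conj definable_pred_imp definable_pred_iff definable1_pred definable2_pred

lemma definable1_ex:
  assumes "definable2 L M R"
  shows "definable1 L M (\<lambda>x. \<exists>y. R x y)"
  unfolding definable1_def
proof
  fix i
  have "definable_pred L M (\<lambda>v. R (v i) (v (Suc i)))"
    using assms by (simp add: definable2_def)
  from definable_pred_ex[OF this, of "Suc i"]
  show "definable_pred L M (\<lambda>v. \<exists>y. R (v i) y)" by simp
qed

lemma definable2_ex:
  assumes "definable3 L M R"
  shows "definable2 L M (\<lambda>x y. \<exists>z. R x y z)"
  unfolding definable2_def
proof (intro allI)
  fix i j
  \<comment> \<open>The variable to be bound must differ from \<open>i\<close> and \<open>j\<close>;
    \<open>Suc (i + j)\<close> exceeds both.\<close>
  have "definable_pred L M (\<lambda>v. R (v i) (v j) (v (Suc (i + j))))"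
    using assms by (simp add: definable3_def)
  from definable_pred_ex[OF this, of "Suc (i + j)"]
  show "definable_pred L M (\<lambda>v. \<exists>z. R (v i) (v j) z)" by simp
qed

lemma definable2_all:
  assumes "definable3 L M R"
  shows "definable2 L M (\<lambda>x y. \<forall>z. R x y z)"
proof -
  have "definable3 L M (\<lambda>x y z. \<not> R x y z)"
    using assms by (simp add: definable3_def definable_pred_not)
  from definable2_ex[OF this] have "definable2 L M (\<lambda>x y. \<not> (\<exists>z. \<not> R x y z))"
    by (simp only: definable2_def definable_pred_not simp_thms)
  then show ?thesis by simp
qed

text \<open>Replaces substitution, and with it the problem of capture: the old variables are bound
  by quantifiers and pinned by equations to the new ones.\<close>

lemma definable_pred_rename:
  assumes R: "definable_pred L M (\<lambda>v. R (v k) (v l))"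
    and fresh: "k \<noteq> l" "i \<notin> {k, l}" "j \<notin> {k, l}"
  shows "definable_pred L M (\<lambda>v. R (v i) (v j))"
proof -
  have "definable_pred L M (\<lambda>v. v k = v i \<and> v l = v j \<and> R (v k) (v l))"
    by (intro definable_intros R)
  from definable_pred_ex[OF definable_pred_ex[OF this, of l], of k]
  show ?thesis using fresh by simp
qed

lemma holds_iff_sat:
  assumes "\<phi> \<in> formulas L n" "length as = n" "\<And>i. i < n \<Longrightarrow> v i = as ! i"
  shows "holds M \<phi> as \<longleftrightarrow> sat M v \<phi>"
  unfolding holds_def using assms by (intro sat_cong) (auto simp: formulas_def)

text \<open>A definable predicate may be written with superfluous free variables; quantifying them away
  existentially does not change it.\<close>

lemma definable_pred_formula:
  assumes "definable_pred L M P"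
    and dep: "\<And>v w. (\<And>i. i < n \<Longrightarrow> v i = w i) \<Longrightarrow> P v = P w"
  obtains \<phi> where "\<phi> \<in> formulas L n" "\<And>v. sat M v \<phi> = P v"
proof -
  have "\<exists>\<psi>. fm_of_lang L \<psi> \<and> free_vars \<psi> \<subseteq> {..<n} \<and> (\<forall>v. sat M v \<psi> = P v)"
    if "finite X" "fm_of_lang L \<phi>" "free_vars \<phi> \<subseteq> {..<n} \<union> X" "\<forall>v. sat M v \<phi> = P v" for X \<phi>
    using that
  proof (induction X arbitrary: \<phi> rule: finite_induct)
    case (insert i X)
    show ?case
    proof (cases "i < n")
      case True
      then show ?thesis using insert.prems by (intro insert.IH) auto
    next
      case False
      have "P (v(i := a)) = P v" for v a
        using False by (intro dep) auto
      then show ?thesis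
        using insert.prems by (intro insert.IH[of "Exists i \<phi>"]) (auto simp del: fun_upd_apply)
    qed
  qed auto
  then show ?thesis
    using assms(1) finite_free_vars that unfolding definable_pred_def formulas_def
    by (metis (no_types, lifting) Un_upper2 mem_Collect_eq)
qed

lemma definable1_formula:
  assumes "definable1 L M P"
  obtains \<phi> where "\<phi> \<in> formulas L 1" "\<And>x. holds M \<phi> [x] = P x"
proof (rule definable_pred_formula[of L M "\<lambda>v. P (v 0)" 1])
  show "definable_pred L M (\<lambda>v. P (v 0))" using assms by (rule definable1_pred)
  fix \<phi> assume \<phi>: "\<phi> \<in> formulas L 1" "\<And>v. sat M v \<phi> = P (v 0)"
  show ?thesis by (rule that[OF \<phi>(1)]) (simp add: holds_def \<phi>(2))
qed simp

lemma definable2_formula: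
  assumes "definable2 L M R"
  obtains \<phi> where "\<phi> \<in> formulas L 2" "\<And>x y. holds M \<phi> [x, y] = R x y"
proof (rule definable_pred_formula[of L M "\<lambda>v. R (v 0) (v 1)" 2])
  show "definable_pred L M (\<lambda>v. R (v 0) (v 1))" using assms by (rule definable2_pred)
  fix \<phi> assume \<phi>: "\<phi> \<in> formulas L 2" "\<And>v. sat M v \<phi> = R (v 0) (v 1)"
  show ?thesis by (rule that[OF \<phi>(1)]) (simp add: holds_def \<phi>(2))
qed simp

lemma definable_rel_iff: "definable_rel L M {(x, y). R x y} \<longleftrightarrow> definable2 L M R"
proof
  assume "definable_rel L M {(x, y). R x y}"
  then obtain \<phi> where \<phi>: "\<phi> \<in> formulas L 2" "{(x, y). R x y} = {(x, y). holds M \<phi> [x, y]}"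
    unfolding definable_rel_def by blast
  have R: "R x y \<longleftrightarrow> holds M \<phi> [x, y]" for x y
    using \<phi>(2) by (simp add: set_eq_iff)
  have "sat M v \<phi> = R (v 0) (v 1)" for v
    unfolding R by (rule holds_iff_sat[OF \<phi>(1), symmetric]) (auto simp: less_2_cases_iff)
  then have base: "definable_pred L M (\<lambda>v. R (v 0) (v 1))"
    using \<phi>(1) unfolding definable_pred_def formulas_def by blast
  show "definable2 L M R"
    unfolding definable2_def
  proof (intro allI)
    fix i j
    \<comment> \<open>As \<open>i\<close> or \<open>j\<close> may be 0 or 1, a direct renaming could
      clash; the detour through two larger indices keeps old and new variables disjoint.\<close>
    have "definable_pred L M (\<lambda>v. R (v (i + j + 2)) (v (i + j + 3)))"
      by (rule definable_pred_rename[where R = R, OF base]) auto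
    then show "definable_pred L M (\<lambda>v. R (v i) (v j))"
      by (rule definable_pred_rename[where R = R]) auto
  qed
next
  assume "definable2 L M R"
  then show "definable_rel L M {(x, y). R x y}"
    by (rule definable2_formula) (auto simp: definable_rel_def)
qed

lemma definable2_less: "definable2 L M (<)" "definable2 L M (>)"
  by (simp_all add: definable2_def definable_pred_less)

subsection \<open>Values crossing a cut\<close>

text \<open>The trace of \<open>a\<close> on \<open>C\<close> can be read off from the positive
  instances in the type of \<open>[a]\<close>, so there are at most as many traces as types.\<close>

lemma linearly_finite_traces:
  assumes "linearly_finite L M" "definable2 L M R"
  obtains k where "\<And>C. initial_part C \<Longrightarrow> finite ((\<lambda>a. {c \<in> C. R a c}) ` (- C))"
    "\<And>C. initial_part C \<Longrightarrow> card ((\<lambda>a. {c \<in> C. R a c}) ` (- C)) \<le> k"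
proof -
  obtain \<phi> where \<phi>: "\<phi> \<in> formulas L (1 + 1)" "\<And>x y. holds M \<phi> [x, y] = R x y"
    using definable2_formula[OF assms(2)] by (metis one_add_one)
  obtain k where k: "initial_part C \<Longrightarrow> finite (phi_type M \<phi> 1 C ` tuples 1 (UNIV - C)) \<and>
        card (phi_type M \<phi> 1 C ` tuples 1 (UNIV - C)) \<le> k" for C
    using assms(1) \<phi>(1) unfolding linearly_finite_def by blast
  have "finite ((\<lambda>a. {c \<in> C. R a c}) ` (- C)) \<and> card ((\<lambda>a. {c \<in> C. R a c}) ` (- C)) \<le> k"
    if "initial_part C" for C
  proof -
    let ?T = "phi_type M \<phi> 1 C ` tuples 1 (UNIV - C)"
    have "{c \<in> C. R a c} = {c. (True, [c]) \<in> phi_type M \<phi> 1 C [a]}" for a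
      by (auto simp: phi_type_def tuples_def \<phi>(2))
    moreover have "[a] \<in> tuples 1 (UNIV - C)" if "a \<notin> C" for a
      using that by (simp add: tuples_def)
    ultimately have "(\<lambda>a. {c \<in> C. R a c}) ` (- C) \<subseteq> (\<lambda>t. {c. (True, [c]) \<in> t}) ` ?T"
      by auto
    then show ?thesis
      using k[OF that] by (meson card_image_le card_mono finite_imageI finite_subset order_trans)
  qed
  then show ?thesis using that by blast
qed

lemma linearly_finite_crossing:
  fixes f :: "'a::linorder \<Rightarrow> 'a"
  assumes "linearly_finite L M" "definable_fun L M f"
  obtains k where "\<And>C. initial_part C \<Longrightarrow> finite (f ` C - C)"
    "\<And>C. initial_part C \<Longrightarrow> card (f ` C - C) \<le> k"
    "\<And>C. initial_part C \<Longrightarrow> finite (f ` (- C) \<inter> C)"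
    "\<And>C. initial_part C \<Longrightarrow> card (f ` (- C) \<inter> C) \<le> k"
proof -
  have G: "definable2 L M (\<lambda>x y. f x = y)"
    using assms(2) by (simp add: definable_fun_def graph_of_def definable_rel_iff)
  then have G': "definable2 L M (\<lambda>y x. f x = y)"
    by (simp add: definable2_def)
  obtain k where k: "initial_part C \<Longrightarrow> finite ((\<lambda>x. {y \<in> C. f x = y}) ` (- C))"
    "initial_part C \<Longrightarrow> card ((\<lambda>x. {y \<in> C. f x = y}) ` (- C)) \<le> k" for C
    using linearly_finite_traces[OF assms(1) G] by blast
  obtain l where l: "initial_part C \<Longrightarrow> finite ((\<lambda>y. {x \<in> C. f x = y}) ` (- C))"
    "initial_part C \<Longrightarrow> card ((\<lambda>y. {x \<in> C. f x = y}) ` (- C)) \<le> l" for C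
    using linearly_finite_traces[OF assms(1) G'] by blast
  \<comment> \<open>For \<open>x\<close> outside \<open>C\<close> with value in \<open>C\<close>,
    the trace is exactly \<open>{f x}\<close>, and \<open>the_elem\<close> recovers the
    value.\<close>
  have down: "f ` (- C) \<inter> C \<subseteq> the_elem ` (\<lambda>x. {y \<in> C. f x = y}) ` (- C)" for C
  proof
    fix y assume "y \<in> f ` (- C) \<inter> C"
    then obtain x where "x \<in> - C" "{z \<in> C. f x = z} = {y}" by auto
    then show "y \<in> the_elem ` (\<lambda>x. {y \<in> C. f x = y}) ` (- C)"
      by (metis (mono_tags, lifting) image_eqI the_elem_eq)
  qed
  \<comment> \<open>Here the trace of \<open>y\<close> is its fibre inside \<open>C\<close>. It is
    nonempty and \<open>f\<close> collapses it to \<open>{y}\<close>, so distinct values have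
    distinct traces.\<close>
  have up: "f ` C - C \<subseteq> (\<lambda>A. the_elem (f ` A)) ` (\<lambda>y. {x \<in> C. f x = y}) ` (- C)" for C
  proof
    fix y assume "y \<in> f ` C - C"
    then have "y \<in> - C" "f ` {x \<in> C. f x = y} = {y}" by auto
    then show "y \<in> (\<lambda>A. the_elem (f ` A)) ` (\<lambda>y. {x \<in> C. f x = y}) ` (- C)"
      by (metis (mono_tags, lifting) image_eqI the_elem_eq)
  qed
  have bound: "finite B \<and> card B \<le> max k l"
    if "B \<subseteq> h ` A" "finite A" "card A \<le> k \<or> card A \<le> l" for A :: "'a set set" and h and B :: "'a set"
  proof -
    have "card B \<le> card A"
      using that by (meson card_image_le card_mono finite_imageI order_trans)
    then show ?thesis
      using that finite_surj by auto
  qed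
  show ?thesis
    by (rule that[of "max k l"]; use bound[OF down] bound[OF up] k l in blast)
qed

subsection \<open>Layers on which a function is increasing\<close>

text \<open>The relation \<open>lt\<close> stands for \<open><\<close> or \<open>>\<close>: the values of \<open>f\<close> above and below the argument
  are treated by the same lemmas, applied to the order and to its dual.\<close>

primrec descents :: "('a \<Rightarrow> 'a \<Rightarrow> bool) \<Rightarrow> ('a \<Rightarrow> 'a) \<Rightarrow> nat \<Rightarrow> 'a \<Rightarrow> bool" where
  "descents lt f 0 x \<longleftrightarrow> True"
| "descents lt f (Suc n) x \<longleftrightarrow> (\<exists>z. lt z x \<and> lt (f x) (f z) \<and> descents lt f n z)"

definition layer :: "('a \<Rightarrow> 'a \<Rightarrow> bool) \<Rightarrow> ('a \<Rightarrow> 'a) \<Rightarrow> nat \<Rightarrow> 'a \<Rightarrow> bool" where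
  "layer lt f j x \<longleftrightarrow> lt x (f x) \<and> descents lt f j x \<and> \<not> descents lt f (Suc j) x"

text \<open>Two points are related if they define the same cut in \<open>Y\<close>: the classes are the singletons
  \<open>{y}\<close> for \<open>y \<in> Y\<close> and the convex components of the complement of \<open>Y\<close>.\<close>

definition same_cut :: "('a \<Rightarrow> 'a \<Rightarrow> bool) \<Rightarrow> 'a set \<Rightarrow> 'a \<Rightarrow> 'a \<Rightarrow> bool" where
  "same_cut lt Y a b \<longleftrightarrow> (\<forall>y. y \<in> Y \<longrightarrow> (lt y a \<longleftrightarrow> lt y b) \<and> (lt a y \<longleftrightarrow> lt b y))"

text \<open>Immediate succession of classes, phrased through representatives so that it is visibly
  first-order in \<open>lt\<close> and \<open>E\<close>.\<close>

definition class_step :: "('a \<Rightarrow> 'a \<Rightarrow> bool) \<Rightarrow> ('a \<Rightarrow> 'a \<Rightarrow> bool) \<Rightarrow> 'a \<Rightarrow> 'a \<Rightarrow> bool" where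
  "class_step lt E a b \<longleftrightarrow>
     lt a b \<and> \<not> E a b \<and> \<not> (\<exists>c. lt a c \<and> lt c b \<and> \<not> E a c \<and> \<not> E c b)"

context linorder
begin

text \<open>If \<open>f z < f x\<close> with \<open>x < z\<close>, then \<open>z\<close> could be
  put in front of the chain of length \<open>j\<close> at \<open>x\<close>, giving a chain of length
  \<open>Suc j\<close> at \<open>z\<close>.\<close>

lemma layer_mono:
  assumes "layer (<) f j x" "layer (<) f j z" "x \<le> z"
  shows "f x \<le> f z"
proof (rule ccontr)
  assume "\<not> f x \<le> f z"
  then have "f z < f x" by simp
  moreover from this have "x < z"
    using assms(3) by (cases "x = z") auto
  ultimately show False
    using assms(1,2) by (auto simp: layer_def)
qed

text \<open>The values along a chain strictly increase, so they are distinct members of the counted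
  set; each further link adds the value \<open>f w\<close>, which the set for \<open>w\<close>
  lacks.\<close>

lemma descents_le_card:
  assumes "descents (<) f n x" "finite {y. f x < y \<and> (\<exists>z. z < x \<and> f z = y)}"
  shows "n \<le> card {y. f x < y \<and> (\<exists>z. z < x \<and> f z = y)}"
  using assms
proof (induction n arbitrary: x)
  case (Suc n)
  let ?A = "\<lambda>x. {y. f x < y \<and> (\<exists>z. z < x \<and> f z = y)}"
  obtain w where w: "w < x" "f x < f w" "descents (<) f n w"
    using Suc.prems by auto
  have sub: "insert (f w) (?A w) \<subseteq> ?A x"
    using w(1,2) by (auto intro: less_trans)
  have "finite (?A w)"
    using finite_subset[OF sub Suc.prems(2)] by simp
  then have "Suc n \<le> card (insert (f w) (?A w))"
    using Suc.IH[OF w(3)] by simp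
  also have "\<dots> \<le> card (?A x)"
    using sub Suc.prems(2) by (rule card_mono[rotated])
  finally show ?case .
qed simp

text \<open>Because \<open>x < f x\<close>, every value beyond \<open>f x\<close> taken below
  \<open>x\<close> also crosses the cut at \<open>x\<close>, so chains have length at most
  \<open>k\<close>.\<close>

lemma ex_layer:
  assumes "x < f x"
    "finite {y. x < y \<and> (\<exists>z. z \<le> x \<and> f z = y)}"
    "card {y. x < y \<and> (\<exists>z. z \<le> x \<and> f z = y)} \<le> k"
  obtains j where "j \<le> k" "layer (<) f j x"
proof -
  let ?A = "{y. f x < y \<and> (\<exists>z. z < x \<and> f z = y)}"
  have sub: "?A \<subseteq> {y. x < y \<and> (\<exists>z. z \<le> x \<and> f z = y)}"
    using assms(1) by (auto dest: less_imp_le less_trans)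
  have A: "finite ?A" "card ?A \<le> k"
    using finite_subset[OF sub assms(2)] card_mono[OF assms(2) sub] assms(3) by auto
  then have "\<not> descents (<) f (Suc k) x"
    using descents_le_card[of f "Suc k" x] by linarith
  moreover have "descents (<) f 0 x" by simp
  \<comment> \<open>\<open>Suc j\<close> is the least length for which no chain exists.\<close>
  ultimately obtain j where "j < Suc k" "descents (<) f j x" "\<not> descents (<) f (Suc j) x"
    using ex_least_nat_less[of "\<lambda>n. \<not> descents (<) f n x" "Suc k"] by auto
  then show ?thesis
    using that[of j] assms(1) by (simp add: layer_def del: descents.simps)
qed

section \<open>Counting steps between the classes cut out by a set\<close>

lemma same_cut_eq: "same_cut (<) Y a y \<Longrightarrow> y \<in> Y \<Longrightarrow> a = y"
  unfolding same_cut_def using less_linear by blast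

text \<open>All points strictly between \<open>x\<close> and \<open>y\<close> define the same cut in
  \<open>Y\<close>. Hence at most one class intervenes: one step if these points are equivalent to
  \<open>x\<close> or absent, two otherwise.\<close>

lemma class_steps_to_consecutive:
  assumes "y \<in> Y" "x < y" "\<And>z. z \<in> Y \<Longrightarrow> x < z \<Longrightarrow> z < y \<Longrightarrow> False"
  obtains n where "n > 0" "n \<le> 2" "(class_step (<) (same_cut (<) Y) ^^ n) x y"
proof -
  let ?E = "same_cut (<) Y"
  have neq: "?E c y \<longleftrightarrow> c = y" for c
    using same_cut_eq assms(1) by (auto simp: same_cut_def)
  have within: "?E c d" if "x < c" "c < y" "x < d" "d < y" for c d
    unfolding same_cut_def
  proof (intro allI impI)
    fix z assume "z \<in> Y"
    then have "z \<le> x \<or> y \<le> z"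
      using assms(3) not_le by blast
    then have "(z < c \<and> z < d) \<or> (c < z \<and> d < z)"
      using that by (meson le_less_trans less_le_trans)
    then show "(z < c \<longleftrightarrow> z < d) \<and> (c < z \<longleftrightarrow> d < z)"
      by (auto dest: less_asym)
  qed
  show ?thesis
  proof (cases "\<exists>c. x < c \<and> c < y \<and> \<not> ?E x c")
    case False
    then have "class_step (<) ?E x y"
      using assms(2) neq by (auto simp: class_step_def)
    then have "(class_step (<) ?E ^^ 1) x y" by (simp only: relpowp_1)
    then show ?thesis using that[of 1] by simp
  next
    case True
    then obtain c where c: "x < c" "c < y" "\<not> ?E x c" by blast
    have "class_step (<) ?E x c"
      using c within[OF _ _ c(1,2)] by (auto simp: class_step_def dest: less_trans)
    moreover have "class_step (<) ?E c y"
      using c within[OF c(1,2)] neq by (auto simp: class_step_def dest: less_trans)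
    ultimately have "(class_step (<) ?E ^^ 2) x y"
      by (auto simp: numeral_2_eq_2)
    then show ?thesis using that[of 2] by simp
  qed
qed

text \<open>The at most \<open>k\<close> points of \<open>Y\<close> in between split the way into at
  most \<open>k + 1\<close> stretches, each costing one or two steps.\<close>

lemma class_steps_to:
  assumes "y \<in> Y" "x < y" "finite (Y \<inter> {x<..<y})" "card (Y \<inter> {x<..<y}) \<le> k"
  shows "\<exists>n. n > 0 \<and> n \<le> 2 * k + 2 \<and> (class_step (<) (same_cut (<) Y) ^^ n) x y"
  using assms
proof (induction k arbitrary: y)
  case 0
  then have "\<And>z. z \<in> Y \<Longrightarrow> x < z \<Longrightarrow> z < y \<Longrightarrow> False" by auto
  then obtain n where "n > 0" "n \<le> 2" "(class_step (<) (same_cut (<) Y) ^^ n) x y"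
    using class_steps_to_consecutive[OF 0(1,2)] by blast
  then show ?case
    by (intro exI[of _ n]) auto
next
  case (Suc k)
  show ?case
  proof (cases "Y \<inter> {x<..<y} = {}")
    case True
    then have "\<And>z. z \<in> Y \<Longrightarrow> x < z \<Longrightarrow> z < y \<Longrightarrow> False" by auto
    then obtain n where "n > 0" "n \<le> 2" "(class_step (<) (same_cut (<) Y) ^^ n) x y"
      using class_steps_to_consecutive[OF Suc.prems(1,2)] by blast
    then show ?thesis
      by (intro exI[of _ n]) auto
  next
    case False
    \<comment> \<open>The last intermediate point: the induction hypothesis leads up to
      \<open>m\<close>, and no point of \<open>Y\<close> separates \<open>m\<close> from
      \<open>y\<close>.\<close>
    define m where "m = Max (Y \<inter> {x<..<y})"
    have m: "m \<in> Y" "x < m" "m < y"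
      using Max_in[OF Suc.prems(3) False] by (auto simp: m_def)
    have max: "z \<le> m" if "z \<in> Y" "x < z" "z < y" for z
      unfolding m_def using that Suc.prems(3) by (intro Max_ge) auto
    have sub: "insert m (Y \<inter> {x<..<m}) \<subseteq> Y \<inter> {x<..<y}"
      using m by (auto intro: less_trans[OF _ m(3)])
    have fin: "finite (Y \<inter> {x<..<m})"
      using finite_subset[OF sub Suc.prems(3)] by simp
    moreover have "card (Y \<inter> {x<..<m}) \<le> k"
      using card_mono[OF Suc.prems(3) sub] Suc.prems(4) fin by simp
    ultimately obtain n where n: "n > 0" "n \<le> 2 * k + 2"
      "(class_step (<) (same_cut (<) Y) ^^ n) x m"
      using Suc.IH[OF m(1,2)] by blast
    have "False" if "z \<in> Y" "m < z" "z < y" for z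
      using max[OF that(1) less_trans[OF m(2) that(2)] that(3)] that(2) by simp
    then obtain n' where n': "n' > 0" "n' \<le> 2" "(class_step (<) (same_cut (<) Y) ^^ n') m y"
      using class_steps_to_consecutive[OF Suc.prems(1) m(3)] by blast
    have "(class_step (<) (same_cut (<) Y) ^^ (n + n')) x y"
      using n(3) n'(3) by (auto simp: relpowp_add)
    then show ?thesis
      using n(1,2) n'(1,2) by (intro exI[of _ "n + n'"]) auto
  qed
qed

lemma layer_class_steps:
  assumes "layer (<) f j x"
    "finite {y. x < y \<and> (\<exists>z. z \<le> x \<and> f z = y)}"
    "card {y. x < y \<and> (\<exists>z. z \<le> x \<and> f z = y)} \<le> k"
  shows "\<exists>n. n > 0 \<and> n \<le> 2 * k + 2 \<and>
    (class_step (<) (same_cut (<) (f ` Collect (layer (<) f j))) ^^ n) x (f x)"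
proof -
  let ?Y = "f ` Collect (layer (<) f j)"
  have sub: "?Y \<inter> {x<..<f x} \<subseteq> {y. x < y \<and> (\<exists>z. z \<le> x \<and> f z = y)}"
  proof
    fix y assume "y \<in> ?Y \<inter> {x<..<f x}"
    then obtain z where z: "layer (<) f j z" "y = f z" "x < y" "f z < f x" by auto
    then have "z \<le> x"
      using layer_mono[OF assms(1) z(1)] by (meson leD le_cases)
    then show "y \<in> {y. x < y \<and> (\<exists>z. z \<le> x \<and> f z = y)}" using z by auto
  qed
  have "finite (?Y \<inter> {x<..<f x})"
    using finite_subset[OF sub assms(2)] .
  moreover have "card (?Y \<inter> {x<..<f x}) \<le> k"
    using card_mono[OF assms(2) sub] assms(3) by linarith
  ultimately show ?thesis
    using assms(1) by (intro class_steps_to) (auto simp: layer_def)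
qed

end

subsection \<open>Definability of the layers and of the equivalence relations\<close>

text \<open>Only the graph of \<open>f\<close> is definable; \<open>f\<close> need not be a term, so
  its value is introduced by a quantifier.\<close>

lemma definable2_comp_left:
  assumes "definable2 L M (\<lambda>x y. f x = y)" "definable2 L M R"
  shows "definable2 L M (\<lambda>x y. R (f x) y)"
proof -
  have "definable2 L M (\<lambda>x y. \<exists>u. f x = u \<and> R u y)"
    using definable2_pred[OF assms(1)] definable2_pred[OF assms(2)]
    by (intro definable2_ex) (simp add: definable3_def definable_pred_conj)
  then show ?thesis by simp
qed

lemma definable2_comp_right:
  assumes "definable2 L M (\<lambda>x y. f x = y)" "definable2 L M R"
  shows "definable2 L M (\<lambda>x y. R x (f y))"
proof -
  have "definable2 L M (\<lambda>x y. \<exists>u. f y = u \<and> R x u)"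
    using assms(1) definable2_pred[OF assms(1)] definable2_pred[OF assms(2)]
    by (intro definable2_ex) (simp add: definable3_def definable_pred_conj)
  then show ?thesis by simp
qed

lemma definable1_diag: "definable2 L M R \<Longrightarrow> definable1 L M (\<lambda>x. R x x)"
  by (simp add: definable1_def definable2_def)

lemma definable1_image:
  assumes "definable2 L M (\<lambda>x y. f x = y)" "definable1 L M P"
  shows "definable1 L M (\<lambda>y. y \<in> f ` Collect P)"
proof -
  have "definable1 L M (\<lambda>y. \<exists>x. P x \<and> f x = y)"
    using definable1_pred[OF assms(2)] definable2_pred[OF assms(1)]
    by (intro definable1_ex) (simp add: definable2_def definable_pred_conj)
  moreover have "y \<in> f ` Collect P \<longleftrightarrow> (\<exists>x. P x \<and> f x = y)" for y
    by auto
  ultimately show ?thesis by simp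
qed

text \<open>The length \<open>n\<close> is fixed outside the formula, so the recursion unfolds into
  finitely many nested quantifiers.\<close>

lemma definable1_descents:
  assumes "definable2 L M lt" "definable2 L M (\<lambda>x y. f x = y)"
  shows "definable1 L M (descents lt f n)"
proof (induction n)
  case 0
  show ?case using definable_pred_eq[of L M 0 0] by (simp add: definable1_def)
next
  case (Suc n)
  have "definable2 L M (\<lambda>x z. lt (f x) (f z))"
    using definable2_comp_left[OF assms(2) definable2_comp_right[OF assms(2,1)]] .
  note pred = definable2_pred[OF this] definable2_pred[OF assms(1)] definable1_pred[OF Suc]
  have "definable1 L M (\<lambda>x. \<exists>z. lt z x \<and> lt (f x) (f z) \<and> descents lt f n z)"
    by (rule definable1_ex, unfold definable2_def) (intro allI definable_pred_conj pred)
  then show ?case by simp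
qed

lemma definable1_layer:
  assumes "definable2 L M lt" "definable2 L M (\<lambda>x y. f x = y)"
  shows "definable1 L M (layer lt f j)"
proof -
  have "definable1 L M (\<lambda>x. lt x (f x))"
    by (rule definable1_diag[OF definable2_comp_right[OF assms(2,1)]])
  then show ?thesis
    using definable1_descents[OF assms] definable1_pred[OF definable1_descents[OF assms]]
    unfolding layer_def[abs_def]
    by (simp del: descents.simps add: definable1_def definable_pred_conj definable_pred_not)
qed

lemma definable2_same_cut:
  assumes "definable2 L M lt" "definable1 L M (\<lambda>y. y \<in> Y)"
  shows "definable2 L M (same_cut lt Y)"
  using definable2_pred[OF assms(1)] definable1_pred[OF assms(2)]
  unfolding same_cut_def[abs_def]
  by (intro definable2_all)
    (simp add: definable3_def definable_pred_conj definable_pred_imp definable_pred_iff)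

lemma definable2_class_step:
  assumes "definable2 L M lt" "definable2 L M E"
  shows "definable2 L M (class_step lt E)"
proof -
  note pred = definable2_pred[OF assms(1)] definable2_pred[OF assms(2)]
  have "definable2 L M (\<lambda>a b. \<exists>c. lt a c \<and> lt c b \<and> \<not> E a c \<and> \<not> E c b)"
    by (intro definable2_ex)
      (simp add: definable3_def definable_pred_conj definable_pred_not pred)
  from definable2_pred[OF this] pred show ?thesis
    unfolding class_step_def[abs_def] definable2_def
    by (intro allI definable_pred_conj definable_pred_not)
qed

lemma definable2_relpowp:
  assumes "definable2 L M R"
  shows "definable2 L M (R ^^ n)"
proof (induction n)
  case 0
  show ?case by (simp add: definable2_def definable_pred_eq)
next
  case (Suc n)
  have "definable2 L M (\<lambda>x z. \<exists>y. (R ^^ n) x y \<and> R y z)"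
    using definable2_pred[OF assms] definable2_pred[OF Suc]
    by (intro definable2_ex) (simp add: definable3_def definable_pred_conj)
  then show ?case by (simp add: OO_def[abs_def])
qed

subsection \<open>Consecutive classes\<close>

lemma convex_equiv_same_cut: "convex_equiv {(a, b). same_cut (<) Y a b}"
proof -
  have "equiv UNIV {(a, b). same_cut (<) Y a b}"
    by (rule equivI) (auto simp: refl_on_def sym_def trans_def same_cut_def)
  moreover have conv: "same_cut (<) Y w b"
    if "same_cut (<) Y w a" "same_cut (<) Y w c" "a \<le> b \<and> b \<le> c" for w a b c
    using that unfolding same_cut_def by (meson le_less_trans less_le_trans)
  ultimately show ?thesis
    unfolding convex_equiv_def
  proof (intro conjI ballI allI impI)
    fix A a c b
    assume A: "A \<in> UNIV // {(a, b). same_cut (<) Y a b}"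
      and mem: "a \<in> A" "c \<in> A" "a \<le> b \<and> b \<le> c"
    obtain w where "A = {b. same_cut (<) Y w b}"
      using A by (auto elim: quotientE)
    then show "b \<in> A"
      using mem conv[of w a c b] by simp
  qed
qed

lemma convex_equivD:
  assumes "convex_equiv E"
  shows "equiv UNIV E" "(a, c) \<in> E \<Longrightarrow> a \<le> b \<Longrightarrow> b \<le> c \<Longrightarrow> (a, b) \<in> E"
proof -
  show eq: "equiv UNIV E" using assms by (simp add: convex_equiv_def)
  assume ac: "(a, c) \<in> E" "a \<le> b" "b \<le> c"
  have "E `` {a} \<in> UNIV // E" "a \<in> E `` {a}"
    using eq by (auto simp: equiv_def refl_on_def intro: quotientI)
  moreover have "c \<in> E `` {a}" using ac(1) by simp
  ultimately have "b \<in> E `` {a}"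
    using assms ac(2,3) unfolding convex_equiv_def by meson
  then show "(a, b) \<in> E" by simp
qed

text \<open>Convex classes cannot interleave, so any two representatives decide the order of
  distinct classes.\<close>

lemma class_less_iff:
  assumes "convex_equiv E"
  shows "class_less (E `` {a}) (E `` {b}) \<longleftrightarrow> a < b \<and> (a, b) \<notin> E"
proof
  note eq = convex_equivD(1)[OF assms] and conv = convex_equivD(2)[OF assms]
  have refl: "(x, x) \<in> E" for x
    using eq by (simp add: equiv_def refl_on_def)
  have sym: "(y, x) \<in> E" if "(x, y) \<in> E" for x y
    using eq that by (auto simp: equiv_def dest: symD)
  have trans: "(x, z) \<in> E" if "(x, y) \<in> E" "(y, z) \<in> E" for x y z
    using eq that by (auto simp: equiv_def dest: transD)
  show "a < b \<and> (a, b) \<notin> E" if "class_less (E `` {a}) (E `` {b})"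
    using that refl unfolding class_less_def by fastforce
  assume ab: "a < b \<and> (a, b) \<notin> E"
  show "class_less (E `` {a}) (E `` {b})"
    unfolding class_less_def
  proof (intro ballI)
    fix a' b' assume "a' \<in> E `` {a}" "b' \<in> E `` {b}"
    then have a': "(a, a') \<in> E" and b': "(b, b') \<in> E" by auto
    have "a' < b"
      \<comment> \<open>Otherwise \<open>b\<close> would lie between \<open>a\<close> and
        \<open>a'\<close> and convexity would make it equivalent to \<open>a\<close>.\<close>
      using ab a' conv[of a a' b] by force
    moreover have "(a', b) \<notin> E"
      using ab a' trans by blast
    \<comment> \<open>Otherwise \<open>a'\<close> would lie between \<open>b'\<close> and
      \<open>b\<close>, hence in the class of \<open>b\<close>.\<close>
    ultimately show "a' < b'"
      using b' conv[of b' b a'] sym trans by (meson less_imp_le not_le)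
  qed
qed

lemma next_class_if_class_step:
  assumes "convex_equiv E" "class_step (<) (\<lambda>a b. (a, b) \<in> E) a b"
  shows "next_class E (E `` {a}) (E `` {b})"
proof -
  have "\<not> (class_less (E `` {a}) D \<and> class_less D (E `` {b}))" if "D \<in> UNIV // E" for D
    using that assms(2) by (auto elim!: quotientE simp: class_less_iff[OF assms(1)] class_step_def)
  then show ?thesis
    using assms by (auto simp: next_class_def quotientI class_less_iff class_step_def)
qed

lemma class_less_linear:
  assumes "convex_equiv E" "A \<in> UNIV // E" "B \<in> UNIV // E"
  shows "class_less A B \<or> A = B \<or> class_less B A"
proof -
  obtain a b where "A = E `` {a}" "B = E `` {b}"
    using assms(2,3) by (auto elim!: quotientE)
  then show ?thesis
    using class_less_iff[OF assms(1)] convex_equivD(1)[OF assms(1)]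
    by (metis equiv_class_eq less_linear UNIV_I eq_equiv_class)
qed

text \<open>Of two different successors the smaller would lie strictly between \<open>A\<close> and
  the larger.\<close>

lemma next_class_right_unique:
  "convex_equiv E \<Longrightarrow> next_class E A B \<Longrightarrow> next_class E A B' \<Longrightarrow> B = B'"
  unfolding next_class_def using class_less_linear by metis

lemma next_class_left_unique:
  "convex_equiv E \<Longrightarrow> next_class E A B \<Longrightarrow> next_class E A' B \<Longrightarrow> A = A'"
  unfolding next_class_def using class_less_linear by metis

lemma class_eq_singleton:
  assumes "equiv UNIV E" "\<And>z. (y, z) \<in> E \<Longrightarrow> z = y"
  shows "E `` {z} = E `` {y} \<longleftrightarrow> z = y"
  using assms eq_equiv_class[of E z y UNIV] by (metis UNIV_I eq_equiv_class)

text \<open>The \<open>n\<close>-th successor class is unique, and here it is the class of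
  \<open>y\<close>, which contains only \<open>y\<close>.\<close>

lemma S_set_class_steps:
  assumes E: "convex_equiv E" and single: "\<And>z. (y, z) \<in> E \<Longrightarrow> z = y"
    and n: "n > 0" "(class_step (<) (\<lambda>a b. (a, b) \<in> E) ^^ n) x y"
  shows "S_set E (int n) x = {y}"
proof -
  have "(next_class E ^^ n) (E `` {a}) (E `` {b})"
    if "(class_step (<) (\<lambda>a b. (a, b) \<in> E) ^^ n) a b" for n a b
    using that by (induction n arbitrary: b) (auto intro: next_class_if_class_step[OF E])
  with n(2) have steps: "(next_class E ^^ n) (E `` {x}) (E `` {y})" by blast
  have "z = y" if "(next_class E ^^ n) (E `` {x}) (E `` {z})" for z
  proof -
    have "E `` {z} = E `` {y}"
      using relpowp_right_unique[OF next_class_right_unique[OF E] that steps] .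
    then show ?thesis
      using class_eq_singleton[OF convex_equivD(1)[OF E] single] by simp
  qed
  moreover have "S_set E (int n) x = {z. (next_class E ^^ n) (E `` {x}) (E `` {z})}"
    using n(1) by (simp add: S_set_def S_rel_def)
  ultimately show ?thesis
    using steps by blast
qed

text \<open>A step for \<open>>\<close> from \<open>a\<close> to \<open>b\<close> is a succession
  from the class of \<open>b\<close> to that of \<open>a\<close>, which matches the reversed
  arguments of \<open>S_rel\<close> at negative indices.\<close>

lemma S_set_class_steps_dual:
  assumes E: "convex_equiv E" and single: "\<And>z. (y, z) \<in> E \<Longrightarrow> z = y"
    and n: "n > 0" "(class_step (>) (\<lambda>a b. (a, b) \<in> E) ^^ n) x y"
  shows "S_set E (- int n) x = {y}"
proof -
  have sym: "(b, a) \<in> E" if "(a, b) \<in> E" for a b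
    using convex_equivD(1)[OF E] that by (auto simp: equiv_def dest: symD)
  have "next_class E (E `` {b}) (E `` {a})" if "class_step (>) (\<lambda>a b. (a, b) \<in> E) a b" for a b
  proof (rule next_class_if_class_step[OF E])
    have "b < a" "(a, b) \<notin> E" and none: "\<And>c. c < a \<Longrightarrow> b < c \<Longrightarrow> (a, c) \<in> E \<or> (c, b) \<in> E"
      using that by (auto simp: class_step_def)
    moreover from this have "(b, a) \<notin> E" using sym by blast
    moreover have "(b, c) \<in> E \<or> (c, a) \<in> E" if "b < c" "c < a" for c
      using none[OF that(2,1)] sym by blast
    ultimately show "class_step (<) (\<lambda>a b. (a, b) \<in> E) b a"
      unfolding class_step_def by blast
  qed
  then have "(next_class E ^^ n) (E `` {b}) (E `` {a})"
    if "(class_step (>) (\<lambda>a b. (a, b) \<in> E) ^^ n) a b" for n a b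
    using that
    \<comment> \<open>Since directions are reversed, a step appended to the point chain is prepended
      to the class chain.\<close>
    by (induction n arbitrary: b) (auto intro: relpowp_Suc_I2 simp del: relpowp.simps(2) elim!: relpowp_Suc_E)
  with n(2) have steps: "(next_class E ^^ n) (E `` {y}) (E `` {x})" by blast
  have "z = y" if "(next_class E ^^ n) (E `` {z}) (E `` {x})" for z
  proof -
    have "E `` {z} = E `` {y}"
      using relpowp_left_unique[OF next_class_left_unique[OF E] that steps] .
    then show ?thesis
      using class_eq_singleton[OF convex_equivD(1)[OF E] single] by simp
  qed
  moreover have "S_set E (- int n) x = {z. (next_class E ^^ n) (E `` {z}) (E `` {x})}"
    using n(1) by (simp add: S_set_def S_rel_def)
  ultimately show ?thesis
    using steps by blast
qed

subsection \<open>The decomposition\<close>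

text \<open>One disjunct of the required definition, with the condition on \<open>x\<close> still a
  predicate; a formula for it is chosen only at the end.\<close>

definition successor_piece ::
    "('f, 'r) lang \<Rightarrow> ('a::linorder, 'f, 'r) struct \<Rightarrow> ('a \<Rightarrow> 'a) \<Rightarrow>
      ('a \<Rightarrow> bool) \<times> ('a \<times> 'a) set \<times> int \<Rightarrow> bool" where
  "successor_piece L M f = (\<lambda>(P, E, N). definable1 L M P \<and> definable_rel L M E \<and> convex_equiv E \<and>
     (\<forall>x. P x \<longrightarrow> S_set E N x = {f x}))"

text \<open>Reversing the order merely swaps the two equivalences, so dualized lemmas yield the same
  relation, convex for \<open><\<close>.\<close>

lemma same_cut_dual: "same_cut (>) Y = same_cut (<) Y"
  by (auto simp: same_cut_def fun_eq_iff)

lemma ex_layer_bound: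
  fixes f :: "'a::linorder \<Rightarrow> 'a"
  assumes "linearly_finite L M" "definable_fun L M f" and lt: "lt \<in> {(<), (>)}"
  obtains k where "\<And>x. lt x (f x) \<Longrightarrow> \<exists>j\<le>k. layer lt f j x \<and>
    (\<exists>n. n > 0 \<and> n \<le> 2 * k + 2 \<and>
      (class_step lt (same_cut (<) (f ` Collect (layer lt f j))) ^^ n) x (f x))"
proof -
  obtain k where k: "\<And>C. initial_part C \<Longrightarrow> finite (f ` C - C)"
    "\<And>C. initial_part C \<Longrightarrow> card (f ` C - C) \<le> k"
    "\<And>C. initial_part C \<Longrightarrow> finite (f ` (- C) \<inter> C)"
    "\<And>C. initial_part C \<Longrightarrow> card (f ` (- C) \<inter> C) \<le> k"
    using linearly_finite_crossing[OF assms(1,2)] by blast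
  \<comment> \<open>The cut must separate \<open>x\<close> from \<open>f x\<close>: for values
    above, \<open>x\<close> belongs to the initial part; for values below, it is left out.\<close>
  have ip: "initial_part {..x}" "initial_part {..<x}" for x :: 'a
    by (auto simp: initial_part_def)
  have up: "f ` {..x} - {..x} = {y. x < y \<and> (\<exists>z. z \<le> x \<and> f z = y)}" for x
    by auto
  have down: "f ` (- {..<x}) \<inter> {..<x} = {y. y < x \<and> (\<exists>z. x \<le> z \<and> f z = y)}" for x
    by auto
  note kup = k(1,2)[OF ip(1), unfolded up] and kdown = k(3,4)[OF ip(2), unfolded down]
  show ?thesis
  proof (rule that[of k])
    fix x
    assume x: "lt x (f x)"
    have "\<exists>j\<le>k. layer lt f j x"
      using lt x ex_layer[OF _ kup] linorder.ex_layer[OF dual_linorder _ kdown] by blast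
    moreover have "\<exists>n. n > 0 \<and> n \<le> 2 * k + 2 \<and>
      (class_step lt (same_cut (<) (f ` Collect (layer lt f j))) ^^ n) x (f x)"
      if "layer lt f j x" for j
      using lt that layer_class_steps[OF _ kup]
        linorder.layer_class_steps[OF dual_linorder _ kdown, unfolded same_cut_dual] by blast
    ultimately show "\<exists>j\<le>k. layer lt f j x \<and> (\<exists>n. n > 0 \<and> n \<le> 2 * k + 2 \<and>
      (class_step lt (same_cut (<) (f ` Collect (layer lt f j))) ^^ n) x (f x))" by blast
  qed
qed

lemma ex_successor_pieces:
  fixes f :: "'a::linorder \<Rightarrow> 'a"
  assumes "linearly_finite L M" "definable_fun L M f"
  obtains T where "finite T" "\<And>p. p \<in> T \<Longrightarrow> successor_piece L M f p"
    "\<And>x. \<exists>(P, E, N)\<in>T. P x"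
proof -
  have G: "definable2 L M (\<lambda>x y. f x = y)"
    using assms(2) by (simp add: definable_fun_def graph_of_def definable_rel_iff)
  define E where "E lt j = same_cut (<) (f ` Collect (layer lt f j))" for lt j
  \<comment> \<open>Fixing the layer and the number of steps makes one relation and one integer
    serve the whole piece.\<close>
  define P where "P lt j n x \<longleftrightarrow> layer lt f j x \<and> (class_step lt (E lt j) ^^ n) x (f x)"
    for lt j n x
  define piece where
    "piece lt s = (\<lambda>(j, n). (P lt j n, {(a, b). E lt j a b}, s * int n))" for lt and s :: int
  have lt_def: "definable2 L M lt" if "lt \<in> {(<), (>)}" for lt
    using that definable2_less by auto
  have defE: "definable2 L M (E lt j)" if "lt \<in> {(<), (>)}" for lt j
    unfolding E_def
    by (intro definable2_same_cut definable2_less definable1_image definable1_layer G lt_def that)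
  have defP: "definable1 L M (P lt j n)" if "lt \<in> {(<), (>)}" for lt j n
  proof -
    have "definable2 L M (class_step lt (E lt j) ^^ n)"
      by (intro definable2_relpowp definable2_class_step lt_def defE that)
    then have "definable1 L M (\<lambda>x. (class_step lt (E lt j) ^^ n) x (f x))"
      by (rule definable1_diag[OF definable2_comp_right[OF G]])
    then show ?thesis
      using definable1_layer[OF lt_def[OF that] G, of j] unfolding P_def[abs_def]
      by (simp add: definable1_def definable_pred_conj)
  qed
  have conv: "convex_equiv {(a, b). E lt j a b}" for lt j
    unfolding E_def by (rule convex_equiv_same_cut)
  have single: "z = f x" if "P lt j n x" "E lt j (f x) z" for lt j n x z
    using that same_cut_eq[of "f ` Collect (layer lt f j)" z "f x"]
    by (auto simp: P_def E_def same_cut_def)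
  have up: "successor_piece L M f (piece (<) 1 (j, n))" if "n > 0" for j n
    using defP defE conv S_set_class_steps[OF conv _ that] single
    by (auto simp: successor_piece_def piece_def definable_rel_iff P_def)
  have down: "successor_piece L M f (piece (>) (- 1) (j, n))" if "n > 0" for j n
    using defP defE conv S_set_class_steps_dual[OF conv _ that] single
    by (auto simp: successor_piece_def piece_def definable_rel_iff P_def)
  have "S_set {(a, b). a = b} 0 x = {x}" for x :: 'a
    by (auto simp: S_set_def S_rel_def)
  moreover have "convex_equiv {(a, b). a = (b :: 'a)}"
  proof -
    \<comment> \<open>Fixed points use equality with integer 0; equality is convex as the cut
      relation of the whole universe.\<close>
    have "same_cut (<) UNIV a b \<longleftrightarrow> a = b" for a b :: 'a
      using same_cut_eq[of UNIV a b] by (auto simp: same_cut_def)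
    then show ?thesis
      using convex_equiv_same_cut[of "UNIV :: 'a set"] by simp
  qed
  moreover have "definable2 L M (\<lambda>a b. a = b)"
    by (simp add: definable2_def definable_pred_eq)
  ultimately have fixed: "successor_piece L M f (\<lambda>x. f x = x, {(a, b). a = b}, 0)"
    using definable1_diag[OF G] by (auto simp: successor_piece_def definable_rel_iff)
  \<comment> \<open>Finitely many layers and step counts suffice; counts start at 1 because index 0
    is reserved for fixed points.\<close>
  let ?J = "\<lambda>k. {..k} \<times> {1..2 * k + 2}"
  have cover: "\<exists>k. \<forall>x. lt x (f x) \<longrightarrow> (\<exists>p\<in>piece lt s ` ?J k. fst p x)"
    if lt: "lt \<in> {(<), (>)}" for lt s
  proof -
    obtain k where k: "\<And>x. lt x (f x) \<Longrightarrow> \<exists>j\<le>k. layer lt f j x \<and>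
      (\<exists>n. n > 0 \<and> n \<le> 2 * k + 2 \<and>
        (class_step lt (same_cut (<) (f ` Collect (layer lt f j))) ^^ n) x (f x))"
      by (rule ex_layer_bound[OF assms lt]) (rule that)
    have "\<exists>i\<in>?J k. fst (piece lt s i) x" if x: "lt x (f x)" for x
    proof -
      obtain j n where "j \<le> k" "n > 0" "n \<le> 2 * k + 2" "P lt j n x"
        using k[OF x] unfolding P_def E_def by blast
      then show ?thesis
        by (intro bexI[of _ "(j, n)"]) (auto simp: piece_def)
    qed
    then show ?thesis
      by (intro exI[of _ k]) simp
  qed
  obtain k where k: "\<forall>x. x < f x \<longrightarrow> (\<exists>p\<in>piece (<) 1 ` ?J k. fst p x)"
    using cover[of "(<)" 1] by auto
  obtain l where l: "\<forall>x. f x < x \<longrightarrow> (\<exists>p\<in>piece (>) (- 1) ` ?J l. fst p x)"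
    using cover[of "(>)" "- 1"] by auto
  let ?T = "insert (\<lambda>x. f x = x, {(a, b). a = b}, 0)
    (piece (<) 1 ` ?J k \<union> piece (>) (- 1) ` ?J l)"
  show ?thesis
  proof (rule that[of ?T])
    fix p assume "p \<in> ?T"
    then show "successor_piece L M f p" using fixed up down by auto
  next
    fix x
    have "\<exists>p\<in>?T. fst p x"
    proof (cases x "f x" rule: linorder_cases)
      case less
      then show ?thesis using k by blast
    next
      case greater
      then show ?thesis using l by blast
    qed simp
    then show "\<exists>(P, E, N)\<in>?T. P x"
      by (simp add: case_prod_beta)
  qed simp
qed

text \<open>The pieces are the restrictions of \<open>f\<close> to the layers for \<open><\<close>,
  to those for \<open>>\<close>, and to the fixed points.\<close>

lemma ex_increasing_pieces:
  fixes f :: "'a::linorder \<Rightarrow> 'a"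
  assumes "linearly_finite L M" "definable_fun L M f"
  shows "\<exists>F. finite F \<and> (\<forall>g\<in>F. definable_rel L M g \<and> increasing_partial_fun g) \<and> graph_of f = \<Union>F"
proof -
  have G: "definable2 L M (\<lambda>x y. f x = y)"
    using assms(2) by (simp add: definable_fun_def graph_of_def definable_rel_iff)
  obtain k where k: "\<exists>j\<le>k. layer (<) f j x" if "x < f x" for x
    by (rule ex_layer_bound[OF assms, of "(<)"]) blast+
  obtain l where l: "\<exists>j\<le>l. layer (>) f j x" if "f x < x" for x
    by (rule ex_layer_bound[OF assms, of "(>)"]) blast+
  define graph where "graph P = {(x, y). P x \<and> f x = y}" for P
  have def: "definable_rel L M (graph P)" if "definable1 L M P" for P
    using definable1_pred[OF that] definable2_pred[OF G] unfolding graph_def definable_rel_iff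
    by (simp add: definable2_def definable_pred_conj)
  have inc: "increasing_partial_fun (graph P)" if "\<And>x z. P x \<Longrightarrow> P z \<Longrightarrow> x \<le> z \<Longrightarrow> f x \<le> f z" for P
    using that by (auto simp: increasing_partial_fun_def graph_def single_valued_def)
  have inc_up: "increasing_partial_fun (graph (layer (<) f j))" for j
    by (rule inc) (rule layer_mono)
  have inc_down: "increasing_partial_fun (graph (layer (>) f j))" for j
    \<comment> \<open>Reversing the order on arguments and values alike preserves
      monotonicity.\<close>
    by (rule inc) (rule linorder.layer_mono[OF dual_linorder])
  have "increasing_partial_fun (graph (\<lambda>x. f x = x))"
    by (rule inc) simp
  note inc = this inc_up inc_down
  let ?F = "insert (graph (\<lambda>x. f x = x))
    ((\<lambda>j. graph (layer (<) f j)) ` {..k} \<union> (\<lambda>j. graph (layer (>) f j)) ` {..l})"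
  have "definable_rel L M g \<and> increasing_partial_fun g" if "g \<in> ?F" for g
    using that def inc definable1_diag[OF G] definable1_layer[OF definable2_less(1) G]
      definable1_layer[OF definable2_less(2) G]
    by auto
  moreover have "graph_of f = \<Union>?F"
  proof -
    have "(x, f x) \<in> \<Union>?F" for x
      using k[of x] l[of x]
      by (cases x "f x" rule: linorder_cases) (auto simp: graph_def)
    then have "graph_of f \<subseteq> \<Union>?F"
      by (auto simp: graph_of_def simp del: Union_iff)
    moreover have "\<Union>?F \<subseteq> graph_of f"
      by (auto simp: graph_of_def graph_def)
    ultimately show ?thesis by (rule equalityI)
  qed
  ultimately show ?thesis
    by (intro exI[of _ ?F]) simp
qed

theorem theorem3p13:
  fixes L :: "('f, 'r) lang"
    and M :: "('a::linorder, 'f, 'r) struct"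
    and f :: "'a \<Rightarrow> 'a"
  assumes "linearly_finite L M"
    and "definable_fun L M f"
  shows "(\<exists>(I :: nat set) (\<theta> :: nat \<Rightarrow> ('f, 'r) fm) (E :: nat \<Rightarrow> ('a \<times> 'a) set) (N :: nat \<Rightarrow> int).
            finite I \<and>
            (\<forall>i\<in>I. \<theta> i \<in> formulas L 1 \<and> definable_rel L M (E i) \<and> convex_equiv (E i)) \<and>
            (\<forall>x y. f x = y \<longleftrightarrow> (\<exists>i\<in>I. holds M (\<theta> i) [x] \<and> S_set (E i) (N i) x = {y})))
       \<and> (\<exists>F :: ('a \<times> 'a) set set.
            finite F \<and>
            (\<forall>g\<in>F. definable_rel L M g \<and> increasing_partial_fun g) \<and>
            graph_of f = \<Union>F)"
proof (rule conjI[OF _ ex_increasing_pieces[OF assms]])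
  obtain T where T: "finite T" "\<And>p. p \<in> T \<Longrightarrow> successor_piece L M f p"
    "\<And>x. \<exists>(P, E, N)\<in>T. P x"
    using ex_successor_pieces[OF assms] by blast
  obtain I :: "nat set" and h where h: "finite I" "T = h ` I"
    using finite_imp_nat_seg_image_inj_on[OF T(1)] by blast
  define P where "P i = fst (h i)" for i
  define E where "E i = fst (snd (h i))" for i
  define N where "N i = snd (snd (h i))" for i
  have "h i = (P i, E i, N i)" for i by (simp add: P_def E_def N_def)
  then have piece: "definable1 L M (P i)" "definable_rel L M (E i)" "convex_equiv (E i)"
    "P i x \<Longrightarrow> S_set (E i) (N i) x = {f x}" if "i \<in> I" for i x
    using T(2)[of "h i"] that by (auto simp: h(2) successor_piece_def)
  have "\<exists>\<phi>. \<phi> \<in> formulas L 1 \<and> (\<forall>x. holds M \<phi> [x] = P i x)" if "i \<in> I" for i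
    by (rule definable1_formula[OF piece(1)[OF that]]) blast
  then obtain \<theta> where \<theta>: "\<theta> i \<in> formulas L 1" "holds M (\<theta> i) [x] = P i x" if "i \<in> I" for i x
    by metis
  have "\<exists>i\<in>I. P i x" for x
    using T(3)[of x] by (auto simp: h(2) P_def case_prod_beta)
  \<comment> \<open>Covering supplies a disjunct for \<open>y = f x\<close>; conversely, any
    disjunct true at \<open>x\<close> has \<open>{f x}\<close> as its set, which forces
    \<open>y = f x\<close>.\<close>
  then have "f x = y \<longleftrightarrow> (\<exists>i\<in>I. holds M (\<theta> i) [x] \<and> S_set (E i) (N i) x = {y})" for x y
    using \<theta>(2) piece(4) by (metis singleton_inject)
  then show "\<exists>(I :: nat set) (\<theta> :: nat \<Rightarrow> ('f, 'r) fm) (E :: nat \<Rightarrow> ('a \<times> 'a) set) (N :: nat \<Rightarrow> int).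
            finite I \<and>
            (\<forall>i\<in>I. \<theta> i \<in> formulas L 1 \<and> definable_rel L M (E i) \<and> convex_equiv (E i)) \<and>
            (\<forall>x y. f x = y \<longleftrightarrow> (\<exists>i\<in>I. holds M (\<theta> i) [x] \<and> S_set (E i) (N i) x = {y}))"
    using h(1) \<theta>(1) piece(2,3)
    by (intro exI[of _ I] exI[of _ \<theta>] exI[of _ E] exI[of _ N] conjI) blast+
qed

end
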